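(* Let $\Psi:\mathbb{R}^n\to\mathbb{R}$ be a mirror potential with Bregman distance $B=B_\Psi$. Let $f:\mathbb{R}^n\to\mathbb{R}$ be a differentiable convex function having a minimizer, and suppose $f$ is $L$-smooth relative to $\Psi$ and $\mu$-strongly-convex relative to $\Psi$, with $L>0$ and $\mu\ge 0$. Let $(\tilde{x}_k)_{k\ge0}$ be a sequence in $\mathbb{R}^n$, and consider the iterations $(x_k)_{k\ge1}$ defined by $$x_{k+1} = \operatorname*{arg\,min}_{x\in\mathbb{R}^n}\left\{\langle x,\nabla f(\tilde{x}_k)\rangle + L\,B(x,\tilde{x}_k)\right\},\qquad k\ge 0,$$ i.e. the result of applying a single mirror descent update step with fixed step size $1/L$ to each $\tilde{x}_k$. Then for any $x\in\mathbb{R}^n$ and every integer $k\ge1$, $$\min_{1\le i\le k} f(\tilde{x}_i) - f(x) \le \frac{\mu B(x,\tilde{x}_0)}{\left(1+\frac{\mu}{L-\mu}\right)^k-1}+M_k \le \frac{L-\mu}{k}B(x,\tilde{x}_0)+M_k,$$ where the middle expression is discarded if $\mu=0$, and where $$M_k = \frac{\sum_{i=1}^k\left(\frac{L}{L-\mu}\right)^i\left[L\langle\nabla\Psi(x_i)-\nabla\Psi(\tilde{x}_i),\,x-\tilde{x}_i\rangle+\langle\nabla f(x_i),\,\tilde{x}_i-x_i\rangle\right]}{\sum_{i=1}^k\left(\frac{L}{L-\mu}\right)^i}.$$ In particular, if $L\langle\nabla\Psi(x_i)-\nabla\Psi(\tilde{x}_i),x-\tilde{x}_i\rangle+\langle\nabla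 f(x_i),\tilde{x}_i-x_i\rangle$ is uniformly bounded from above by $M$, then $M_k$ can be replaced by $M$ in the displayed bounds.
   Context: A mirror potential is a continuously differentiable, strongly convex function $\Psi:\mathbb{R}^n\to\mathbb{R}$. Its Bregman distance is $B_\Psi(x,y)=\Psi(x)-\Psi(y)-\langle\nabla\Psi(y),x-y\rangle$. A mirror descent update step with step size $t>0$ applied to a point $z$ returns $\operatorname*{arg\,min}_{x\in\mathbb{R}^n}\{\langle x,t\nabla f(z)\rangle+B_\Psi(x,z)\}$. A differentiable convex function $f$ is $L$-smooth relative to $\Psi$ if $f(y)\le f(x)+\langle\nabla f(x),y-x\rangle+L B_\Psi(y,x)$ for all $x,y\in\mathbb{R}^n$. It is $\mu$-strongly-convex relative to $\Psi$ if $f(y)\ge f(x)+\langle\nabla f(x),y-x\rangle+\mu B_\Psi(y,x)$ for all $x,y\in\mathbb{R}^n$. *)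

theory Defs
  imports "HOL-Analysis.Analysis"
begin

definition grad :: "('a::real_inner \<Rightarrow> real) \<Rightarrow> 'a \<Rightarrow> 'a" where
  "grad f x = (THE D. GDERIV f x :> D)"

lemma GDERIV_grad:
  fixes f :: "'a::euclidean_space \<Rightarrow> real"
  assumes "f differentiable (at x)"
  shows "GDERIV f x :> grad f x"
proof -
  obtain f' where f': "(f has_derivative f') (at x)"
    using assms by (auto simp: differentiable_def)
  interpret linear f' using f' by (rule has_derivative_linear)
  define D where "D = (\<Sum>b\<in>Basis. f' b *\<^sub>R b)"
  have "f' = (\<lambda>h. h \<bullet> D)"
  proof
    fix h
    have "f' h = f' (\<Sum>b\<in>Basis. (h \<bullet> b) *\<^sub>R b)"
      by (simp add: euclidean_representation)
    also have "\<dots> = h \<bullet> D"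
      unfolding sum scale by (simp add: D_def inner_sum_right mult.commute)
    finally show "f' h = h \<bullet> D" .
  qed
  then have D: "GDERIV f x :> D"
    using f' by (simp add: gderiv_def)
  moreover have "E = D" if "GDERIV f x :> E" for E
  proof -
    have "(\<lambda>h. h \<bullet> E) = (\<lambda>h. h \<bullet> D)"
      using that D unfolding gderiv_def by (rule has_derivative_unique)
    then have "\<forall>h. h \<bullet> E = h \<bullet> D"
      by (simp add: fun_eq_iff)
    then show ?thesis
      by (simp only: vector_eq_ldot)
  qed
  ultimately show ?thesis
    unfolding grad_def by (rule theI)
qed

definition strongly_convex :: "('a::real_inner \<Rightarrow> real) \<Rightarrow> bool" where
  "strongly_convex F \<longleftrightarrow> (\<exists>\<sigma>>0. \<forall>x y. \<forall>t\<in>{0..1}.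
     F ((1 - t) *\<^sub>R x + t *\<^sub>R y)
       \<le> (1 - t) * F x + t * F y - \<sigma> / 2 * t * (1 - t) * (norm (x - y))\<^sup>2)"

definition mirror_potential :: "('a::real_inner \<Rightarrow> real) \<Rightarrow> bool" where
  "mirror_potential \<Psi> \<longleftrightarrow>
     (\<forall>x. \<Psi> differentiable (at x)) \<and> continuous_on UNIV (grad \<Psi>) \<and> strongly_convex \<Psi>"

definition bregman :: "('a::real_inner \<Rightarrow> real) \<Rightarrow> 'a \<Rightarrow> 'a \<Rightarrow> real" where
  "bregman \<Psi> x y = \<Psi> x - \<Psi> y - grad \<Psi> y \<bullet> (x - y)"

definition rel_smooth :: "('a::real_inner \<Rightarrow> real) \<Rightarrow> real \<Rightarrow> ('a \<Rightarrow> real) \<Rightarrow> bool" where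
  "rel_smooth \<Psi> L f \<longleftrightarrow>
     (\<forall>x y. f y \<le> f x + grad f x \<bullet> (y - x) + L * bregman \<Psi> y x)"

definition rel_strongly_convex :: "('a::real_inner \<Rightarrow> real) \<Rightarrow> real \<Rightarrow> ('a \<Rightarrow> real) \<Rightarrow> bool" where
  "rel_strongly_convex \<Psi> \<mu> f \<longleftrightarrow>
     (\<forall>x y. f y \<ge> f x + grad f x \<bullet> (y - x) + \<mu> * bregman \<Psi> y x)"

definition mirror_step :: "('a::real_inner \<Rightarrow> real) \<Rightarrow> ('a \<Rightarrow> real) \<Rightarrow> real \<Rightarrow> 'a \<Rightarrow> 'a" where
  "mirror_step \<Psi> f t z = (ARG_MIN (\<lambda>x. x \<bullet> (t *\<^sub>R grad f z) + bregman \<Psi> x z) x. True)"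

lemma mirror_step_inverse:
  assumes "L > 0"
  shows "mirror_step \<Psi> f (1 / L) z =
    (ARG_MIN (\<lambda>x. x \<bullet> grad f z + L * bregman \<Psi> x z) x. True)"
proof -
  have scale: "y \<bullet> grad f z + L * bregman \<Psi> y z =
      L * (y \<bullet> ((1 / L) *\<^sub>R grad f z) + bregman \<Psi> y z)" for y
    using assms by (simp add: distrib_left)
  show ?thesis
    using assms by (simp only: mirror_step_def arg_min_def is_arg_min_def scale mult_less_cancel_left_pos)
qed

text \<open>The contribution of the pair \<open>x\<^sub>i\<close>, \<open>xt\<^sub>i\<close> (arguments \<open>y\<close>, \<open>z\<close>) to \<open>M\<^sub>k\<close>, for the
  comparison point \<open>u\<close>. The weights \<open>L / (L - \<mu>)\<close> of \<open>M\<^sub>k\<close> only make sense for \<open>\<mu> \<noteq> L\<close>.\<close>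

definition step_error ::
  "('a::real_inner \<Rightarrow> real) \<Rightarrow> ('a \<Rightarrow> real) \<Rightarrow> real \<Rightarrow> 'a \<Rightarrow> 'a \<Rightarrow> 'a \<Rightarrow> real" where
  "step_error \<Psi> f L u y z =
     L * ((grad \<Psi> y - grad \<Psi> z) \<bullet> (u - z)) + grad f y \<bullet> (z - y)"

definition avg_error ::
  "('a::real_inner \<Rightarrow> real) \<Rightarrow> ('a \<Rightarrow> real) \<Rightarrow> real \<Rightarrow> real \<Rightarrow> 'a \<Rightarrow> (nat \<Rightarrow> 'a) \<Rightarrow> (nat \<Rightarrow> 'a)
     \<Rightarrow> nat \<Rightarrow> real" where
  "avg_error \<Psi> f L \<mu> u x xt k =
     (\<Sum>i=1..k. (L / (L - \<mu>)) ^ i * step_error \<Psi> f L u (x i) (xt i))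
       / (\<Sum>i=1..k. (L / (L - \<mu>)) ^ i)"

end

theory Submission
  imports Defs
begin

text \<open>The average of the gaps \<open>f (xt i) - f u\<close> with the geometric weights \<open>r ^ i\<close>, where
  \<open>r = L / (L - \<mu>)\<close>, dominates the smallest gap, so it suffices to bound this average. Write
  \<open>B\<close> for the Bregman distance. The optimality condition of the mirror step that produces
  \<open>x (i + 1)\<close> from \<open>xt i\<close> says that \<open>grad f (xt i)\<close> is
  \<open>L *\<^sub>R (grad \<Psi> (xt i) - grad \<Psi> (x (i + 1)))\<close>. Combining relative smoothness (between \<open>xt i\<close> and
  \<open>x (i + 1)\<close>), relative strong convexity (between \<open>xt i\<close> and \<open>u\<close>) and the three-point identity
  for \<open>B\<close> gives
  \<open>f (x (i + 1)) - f u \<le> (L - \<mu>) * B u (xt i) - L * B u (x (i + 1))\<close>.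
  By relative smoothness and the three-point identity once more, \<open>x (i + 1)\<close> may be replaced on
  both sides by \<open>xt (i + 1)\<close>, the base point of the next step, at the cost of adding the step
  error on the right (\<open>mirror_step_gap\<close>).

  Since \<open>r * (L - \<mu>) = L\<close>, the distances telescope after multiplication by the weights, and only
  \<open>L * B u (xt 0)\<close> remains (\<open>weighted_telescoping\<close>). Dividing by the total weight \<open>W\<close> yields
  the factor \<open>L / W\<close>, which is \<open>\<mu> / (r ^ k - 1)\<close> by summing the geometric series, and which is
  at most \<open>(L - \<mu>) / k\<close> because each of the \<open>k\<close> weights is at least \<open>r\<close>.

  Strong convexity of \<open>\<Psi>\<close> enters as a quadratic lower bound for \<open>B\<close>
  (\<open>bregman_ge_quadratic\<close>). Besides \<open>B \<ge> 0\<close>, it implies that the minimum in the mirror step is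
  attained, and that \<open>\<mu> \<le> L\<close>, so that \<open>L \<noteq> \<mu>\<close> makes \<open>L - \<mu>\<close> positive.\<close>

section \<open>Bregman distances\<close>

text \<open>Strong convexity on the segment from \<open>y\<close> to \<open>x\<close> bounds the difference quotient of \<open>\<Psi>\<close> at
  \<open>y\<close> in the direction \<open>x - y\<close>; the bound follows as the step along the segment tends to zero.\<close>

lemma bregman_ge_quadratic:
  fixes \<Psi> :: "'a::euclidean_space \<Rightarrow> real"
  assumes "mirror_potential \<Psi>"
  obtains \<sigma> where "\<sigma> > 0" "\<And>x y. bregman \<Psi> x y \<ge> \<sigma> / 2 * (norm (x - y))\<^sup>2"
proof -
  from assms obtain \<sigma> where \<sigma>: "\<sigma> > 0" and sc: "\<And>x y t. t \<in> {0..1} \<Longrightarrow>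
     \<Psi> ((1 - t) *\<^sub>R x + t *\<^sub>R y)
       \<le> (1 - t) * \<Psi> x + t * \<Psi> y - \<sigma> / 2 * t * (1 - t) * (norm (x - y))\<^sup>2"
    unfolding mirror_potential_def strongly_convex_def by metis
  have "bregman \<Psi> x y \<ge> \<sigma> / 2 * (norm (x - y))\<^sup>2" for x y
  proof -
    have "(\<Psi> has_derivative (\<lambda>h. h \<bullet> grad \<Psi> y)) (at y)"
      using assms GDERIV_grad[of \<Psi> y] unfolding mirror_potential_def gderiv_def by blast
    then have "(\<Psi> has_derivative (\<lambda>h. h \<bullet> grad \<Psi> y)) (at (y + 0 *\<^sub>R (x - y)))"
      by simp
    moreover have "((\<lambda>t. y + t *\<^sub>R (x - y)) has_derivative (\<lambda>t. t *\<^sub>R (x - y))) (at 0)"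
      by (auto intro!: derivative_eq_intros)
    ultimately have "((\<lambda>t. \<Psi> (y + t *\<^sub>R (x - y)))
        has_derivative (\<lambda>t. (t *\<^sub>R (x - y)) \<bullet> grad \<Psi> y)) (at 0)"
      by (rule has_derivative_compose[rotated])
    then have "((\<lambda>t. \<Psi> (y + t *\<^sub>R (x - y))) has_real_derivative (x - y) \<bullet> grad \<Psi> y) (at 0)"
      by (simp add: has_field_derivative_def mult.commute[of _ "(x - y) \<bullet> grad \<Psi> y"])
    then have "((\<lambda>t. (\<Psi> (y + t *\<^sub>R (x - y)) - \<Psi> y) / t) \<longlongrightarrow> (x - y) \<bullet> grad \<Psi> y) (at 0)"
      by (simp add: DERIV_def)
    then have lim: "((\<lambda>t. (\<Psi> (y + t *\<^sub>R (x - y)) - \<Psi> y) / t) \<longlongrightarrow> (x - y) \<bullet> grad \<Psi> y)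
        (at_right 0)"
      by (rule tendsto_mono[rotated]) (simp add: at_le)
    have lim': "((\<lambda>t. \<Psi> x - \<Psi> y - \<sigma> / 2 * (1 - t) * (norm (x - y))\<^sup>2) \<longlongrightarrow>
        \<Psi> x - \<Psi> y - \<sigma> / 2 * (1 - 0) * (norm (x - y))\<^sup>2) (at_right 0)"
      by (intro tendsto_intros)
    have "\<forall>\<^sub>F t in at_right 0. (\<Psi> (y + t *\<^sub>R (x - y)) - \<Psi> y) / t
        \<le> \<Psi> x - \<Psi> y - \<sigma> / 2 * (1 - t) * (norm (x - y))\<^sup>2"
      using eventually_at_right_real[OF zero_less_one]
    proof eventually_elim
      case (elim t)
      have "y + t *\<^sub>R (x - y) = (1 - t) *\<^sub>R y + t *\<^sub>R x"
        by (simp add: algebra_simps)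
      moreover have "\<Psi> ((1 - t) *\<^sub>R y + t *\<^sub>R x)
          \<le> (1 - t) * \<Psi> y + t * \<Psi> x - \<sigma> / 2 * t * (1 - t) * (norm (y - x))\<^sup>2"
        using elim by (intro sc) auto
      ultimately have "\<Psi> (y + t *\<^sub>R (x - y)) - \<Psi> y
          \<le> (\<Psi> x - \<Psi> y - \<sigma> / 2 * (1 - t) * (norm (x - y))\<^sup>2) * t"
        by (simp add: algebra_simps norm_minus_commute)
      then show ?case
        using elim by (simp add: pos_divide_le_eq)
    qed
    then have "(x - y) \<bullet> grad \<Psi> y \<le> \<Psi> x - \<Psi> y - \<sigma> / 2 * (1 - 0) * (norm (x - y))\<^sup>2"
      by (rule tendsto_le[OF trivial_limit_at_right_real lim' lim])
    then show ?thesis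
      by (simp add: bregman_def inner_commute)
  qed
  with \<sigma> show ?thesis
    by (rule that)
qed

lemma bregman_nonneg:
  fixes \<Psi> :: "'a::euclidean_space \<Rightarrow> real"
  assumes "mirror_potential \<Psi>"
  shows "bregman \<Psi> x y \<ge> 0"
proof -
  obtain \<sigma> where "\<sigma> > 0" "bregman \<Psi> x y \<ge> \<sigma> / 2 * (norm (x - y))\<^sup>2"
    using bregman_ge_quadratic[OF assms] by metis
  moreover have "\<sigma> / 2 * (norm (x - y))\<^sup>2 \<ge> 0"
    using \<open>\<sigma> > 0\<close> by simp
  ultimately show ?thesis
    by linarith
qed

lemma bregman_three_point:
  "bregman \<Psi> u z = bregman \<Psi> u y + bregman \<Psi> y z + (grad \<Psi> y - grad \<Psi> z) \<bullet> (u - y)"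
  by (simp add: bregman_def algebra_simps)

text \<open>At a pair of distinct points, the upper and the lower bound on \<open>f\<close> can only be compatible if
  \<open>\<mu> * B \<le> L * B\<close> for a positive Bregman distance \<open>B\<close>.\<close>

lemma rel_convexity_le_rel_smoothness:
  fixes \<Psi> f :: "'a::euclidean_space \<Rightarrow> real"
  assumes "mirror_potential \<Psi>" "rel_smooth \<Psi> L f" "rel_strongly_convex \<Psi> \<mu> f"
  shows "\<mu> \<le> L"
proof -
  obtain b :: 'a where b: "b \<in> Basis"
    using nonempty_Basis by blast
  obtain \<sigma> where "\<sigma> > 0" "bregman \<Psi> b 0 \<ge> \<sigma> / 2 * (norm (b - 0))\<^sup>2"
    using bregman_ge_quadratic[OF assms(1)] by metis
  then have "bregman \<Psi> b 0 > 0"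
    using b by simp
  moreover have "\<mu> * bregman \<Psi> b 0 \<le> L * bregman \<Psi> b 0"
    using assms(2,3) unfolding rel_smooth_def rel_strongly_convex_def
    by (meson add_le_cancel_left order_trans)
  ultimately show ?thesis
    by simp
qed

section \<open>The mirror step\<close>

text \<open>By the quadratic lower bound on the Bregman distance, outside of some ball around \<open>z\<close>
  the objective is at least its value at \<open>z\<close>, so its minimum over this ball is a global one.\<close>

lemma mirror_objective_has_minimizer:
  fixes \<Psi> :: "'a::euclidean_space \<Rightarrow> real"
  assumes \<Psi>: "mirror_potential \<Psi>" and L: "L > 0"
  shows "\<exists>y. \<forall>w. y \<bullet> g + L * bregman \<Psi> y z \<le> w \<bullet> g + L * bregman \<Psi> w z"
proof -
  define \<phi> where "\<phi> = (\<lambda>w. w \<bullet> g + L * bregman \<Psi> w z)"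
  obtain \<sigma> where \<sigma>: "\<sigma> > 0" "\<And>x y. bregman \<Psi> x y \<ge> \<sigma> / 2 * (norm (x - y))\<^sup>2"
    using bregman_ge_quadratic[OF \<Psi>] by metis
  \<comment> \<open>The radius at which the quadratic term overtakes the linear one.\<close>
  define R where "R = 2 * norm g / (L * \<sigma>)"
  have "R \<ge> 0"
    using \<sigma>(1) L by (simp add: R_def)
  have "continuous_on UNIV \<Psi>"
    using \<Psi> unfolding mirror_potential_def
    by (simp add: differentiable_imp_continuous_within continuous_on_eq_continuous_within)
  then have "continuous_on (cball z R) \<phi>"
    unfolding \<phi>_def bregman_def
    by (intro continuous_intros) (auto elim: continuous_on_subset)
  then obtain y where y: "y \<in> cball z R" "\<And>w. w \<in> cball z R \<Longrightarrow> \<phi> y \<le> \<phi> w"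
    using continuous_attains_inf[of "cball z R" \<phi>] \<open>R \<ge> 0\<close> by auto
  have "\<phi> y \<le> \<phi> w" for w
  proof (cases "w \<in> cball z R")
    case False
    then have "norm (w - z) > R"
      by (simp add: dist_norm norm_minus_commute)
    then have "norm g \<le> L * (\<sigma> / 2 * norm (w - z))"
      using \<sigma>(1) L by (simp add: R_def field_simps)
    then have "norm (w - z) * norm g \<le> norm (w - z) * (L * (\<sigma> / 2 * norm (w - z)))"
      by (intro mult_left_mono) auto
    also have "\<dots> = L * (\<sigma> / 2 * (norm (w - z))\<^sup>2)"
      by (simp add: power2_eq_square)
    also have "\<dots> \<le> L * bregman \<Psi> w z"
      using \<sigma>(2) L by (intro mult_left_mono) auto
    finally have "norm (w - z) * norm g \<le> L * bregman \<Psi> w z" .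
    moreover have "- (norm (w - z) * norm g) \<le> (w - z) \<bullet> g"
      using Cauchy_Schwarz_ineq2[of "w - z" g] by linarith
    ultimately have "\<phi> z \<le> \<phi> w"
      by (simp add: \<phi>_def bregman_def inner_diff_left)
    moreover have "\<phi> y \<le> \<phi> z"
      using \<open>R \<ge> 0\<close> by (intro y(2)) simp
    ultimately show ?thesis
      by simp
  qed (rule y(2))
  then show ?thesis
    unfolding \<phi>_def by blast
qed

lemma mirror_step_optimality:
  fixes \<Psi> :: "'a::euclidean_space \<Rightarrow> real"
  assumes \<Psi>: "mirror_potential \<Psi>" and L: "L > 0"
    and y: "y = (ARG_MIN (\<lambda>w. w \<bullet> g + L * bregman \<Psi> w z) w. True)"
  shows "g = L *\<^sub>R (grad \<Psi> z - grad \<Psi> y)"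
proof -
  define \<phi> where "\<phi> = (\<lambda>w. w \<bullet> g + L * bregman \<Psi> w z)"
  obtain y' where "\<forall>w. \<phi> y' \<le> \<phi> w"
    using mirror_objective_has_minimizer[OF \<Psi> L] unfolding \<phi>_def by blast
  then have "is_arg_min \<phi> (\<lambda>_. True) y'"
    by (simp add: is_arg_min_linorder)
  then have "is_arg_min \<phi> (\<lambda>_. True) y"
    unfolding y \<phi>_def arg_min_def by (rule someI)
  then have min: "\<forall>w\<in>UNIV. \<phi> y \<le> \<phi> w"
    by (simp add: is_arg_min_linorder)
  have "(\<Psi> has_derivative (\<lambda>h. h \<bullet> grad \<Psi> y)) (at y)"
    using \<Psi> GDERIV_grad[of \<Psi> y] unfolding mirror_potential_def gderiv_def by blast
  then have "(\<phi> has_derivative (\<lambda>h. h \<bullet> g + L * (h \<bullet> grad \<Psi> y - grad \<Psi> z \<bullet> h))) (at y)"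
    unfolding \<phi>_def bregman_def by (auto intro!: derivative_eq_intros)
  then have "(\<lambda>h. h \<bullet> g + L * (h \<bullet> grad \<Psi> y - grad \<Psi> z \<bullet> h)) = (\<lambda>h. 0)"
    using min by (intro differential_zero_maxmin[of y UNIV \<phi>]) auto
  then have zero: "h \<bullet> g + L * (h \<bullet> grad \<Psi> y - grad \<Psi> z \<bullet> h) = 0" for h
    by (simp add: fun_eq_iff)
  have "h \<bullet> g = h \<bullet> (L *\<^sub>R (grad \<Psi> z - grad \<Psi> y))" for h
    using zero[of h]
    by (simp add: inner_diff_right inner_commute[of "grad \<Psi> z"] right_diff_distrib)
  then show ?thesis
    using vector_eq_ldot by blast
qed

text \<open>Of the mirror step from \<open>z\<close> to \<open>y\<close>, only the optimality condition \<open>opt\<close> matters; \<open>w\<close> is the base point of the following step, which may differ from \<open>y\<close>.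
  For \<open>w = y\<close> the step error vanishes and this is the usual one-step estimate.\<close>

lemma mirror_step_gap:
  assumes smooth: "rel_smooth \<Psi> L f" and convex: "rel_strongly_convex \<Psi> \<mu> f"
    and opt: "grad f z = L *\<^sub>R (grad \<Psi> z - grad \<Psi> y)"
  shows "f w - f u \<le> (L - \<mu>) * bregman \<Psi> u z - L * bregman \<Psi> u w + step_error \<Psi> f L u y w"
proof -
  have "f y - f u \<le> grad f z \<bullet> (y - z) - grad f z \<bullet> (u - z) + L * bregman \<Psi> y z - \<mu> * bregman \<Psi> u z"
    using smooth[unfolded rel_smooth_def, rule_format, of y z]
      convex[unfolded rel_strongly_convex_def, rule_format, of z u] by linarith
  also have "grad f z \<bullet> (y - z) - grad f z \<bullet> (u - z) = L * ((grad \<Psi> y - grad \<Psi> z) \<bullet> (u - y))"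
    unfolding opt by (simp add: algebra_simps)
  also have "(grad \<Psi> y - grad \<Psi> z) \<bullet> (u - y) = bregman \<Psi> u z - bregman \<Psi> u y - bregman \<Psi> y z"
    using bregman_three_point[of \<Psi> u z y] by simp
  finally have at_y: "f y - f u \<le> (L - \<mu>) * bregman \<Psi> u z - L * bregman \<Psi> u y"
    by (simp add: algebra_simps)
  have "f w - f y \<le> grad f y \<bullet> (w - y) + L * bregman \<Psi> w y"
    using smooth[unfolded rel_smooth_def, rule_format, of w y] by linarith
  also have "bregman \<Psi> w y = bregman \<Psi> u y - bregman \<Psi> u w + (grad \<Psi> y - grad \<Psi> w) \<bullet> (u - w)"
    using bregman_three_point[of \<Psi> u y w] by (simp add: inner_diff_left)
  finally have "f w - f y \<le> L * bregman \<Psi> u y - L * bregman \<Psi> u w + step_error \<Psi> f L u y w"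
    by (simp add: step_error_def algebra_simps)
  with at_y show ?thesis
    by linarith
qed

section \<open>Geometric averaging\<close>

text \<open>The ratio \<open>r = L / (L - \<mu>)\<close> is chosen such that \<open>r ^ (i + 1) * (L - \<mu>) = L * r ^ i\<close>: the
  term with \<open>b i\<close> in one step cancels the one left over from the previous step.\<close>

lemma weighted_telescoping:
  fixes L \<mu> :: real and b d e :: "nat \<Rightarrow> real"
  assumes L: "L > 0" "\<mu> < L"
    and step: "\<And>i. d (Suc i) \<le> (L - \<mu>) * b i - L * b (Suc i) + e (Suc i)"
  shows "(\<Sum>i=1..k. (L / (L - \<mu>)) ^ i * d i) + L * (L / (L - \<mu>)) ^ k * b k
    \<le> L * b 0 + (\<Sum>i=1..k. (L / (L - \<mu>)) ^ i * e i)"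
proof (induction k)
  case (Suc k)
  define r where "r = L / (L - \<mu>)"
  have r: "r * (L - \<mu>) = L" "r > 0"
    using L by (simp_all add: r_def)
  have "r ^ Suc k * d (Suc k) \<le> r ^ Suc k * ((L - \<mu>) * b k - L * b (Suc k) + e (Suc k))"
    using r(2) by (intro mult_left_mono step) simp
  also have "\<dots> = (r * (L - \<mu>)) * r ^ k * b k - L * r ^ Suc k * b (Suc k) + r ^ Suc k * e (Suc k)"
    by (simp add: algebra_simps)
  finally have "r ^ Suc k * d (Suc k)
      \<le> L * r ^ k * b k - L * r ^ Suc k * b (Suc k) + r ^ Suc k * e (Suc k)"
    unfolding r(1) .
  with Suc.IH show ?case
    unfolding r_def[symmetric] by simp
qed simp

text \<open>Without dividing by \<open>\<mu>\<close>, the formula for the geometric sum also covers the ratio 1.\<close>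

lemma geometric_weight_sum:
  fixes L \<mu> :: real
  assumes "L \<noteq> \<mu>"
  shows "\<mu> * (\<Sum>i=1..k. (L / (L - \<mu>)) ^ i) = L * ((L / (L - \<mu>)) ^ k - 1)"
proof (induction k)
  case (Suc k)
  define r where "r = L / (L - \<mu>)"
  have "(L - \<mu>) * r = L"
    using assms by (simp add: r_def)
  then have "(L - \<mu>) * r ^ Suc k = L * r ^ k"
    by (simp add: mult.assoc[symmetric])
  with Suc.IH show ?case
    unfolding r_def[symmetric] by (simp add: algebra_simps)
qed simp

lemma geometric_weight_sum_ge:
  fixes L \<mu> :: real
  assumes "0 \<le> \<mu>" "\<mu> < L"
  shows "(\<Sum>i=1..k. (L / (L - \<mu>)) ^ i) \<ge> real k * (L / (L - \<mu>))"
proof -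
  have "(\<Sum>i=1..k. L / (L - \<mu>)) \<le> (\<Sum>i=1..k. (L / (L - \<mu>)) ^ i)"
    using assms by (intro sum_mono self_le_power) (auto simp: field_simps)
  then show ?thesis
    by simp
qed

lemma geometric_average_factor:
  fixes L \<mu> :: real
  assumes "0 \<le> \<mu>" "\<mu> < L" "k \<ge> 1"
  defines "W \<equiv> \<Sum>i=1..k. (L / (L - \<mu>)) ^ i"
  shows "W > 0"
    and "L / W \<le> (L - \<mu>) / real k"
    and "\<mu> \<noteq> 0 \<Longrightarrow> \<mu> / ((1 + \<mu> / (L - \<mu>)) ^ k - 1) = L / W"
proof -
  have W: "W \<ge> real k * (L / (L - \<mu>))"
    using geometric_weight_sum_ge[OF assms(1,2)] by (simp add: W_def)
  moreover have "real k * (L / (L - \<mu>)) > 0"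
    using assms by simp
  ultimately show pos: "W > 0"
    by linarith
  show "L / W \<le> (L - \<mu>) / real k"
    using W pos assms(2,3) by (simp add: field_simps)
  show "\<mu> / ((1 + \<mu> / (L - \<mu>)) ^ k - 1) = L / W" if "\<mu> \<noteq> 0"
  proof -
    have "1 + \<mu> / (L - \<mu>) = L / (L - \<mu>)"
      using assms(2) by (simp add: field_simps)
    moreover have eq: "\<mu> * W = L * ((L / (L - \<mu>)) ^ k - 1)"
      using geometric_weight_sum[of L \<mu> k] assms(2) by (simp add: W_def)
    moreover have "(L / (L - \<mu>)) ^ k - 1 \<noteq> 0"
      using eq pos that by auto
    ultimately show ?thesis
      using pos by (simp add: frac_eq_eq)
  qed
qed

lemma avg_error_le:
  assumes "0 \<le> \<mu>" "\<mu> < L" "k \<ge> 1"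
    and M: "\<And>i. i \<ge> 1 \<Longrightarrow> step_error \<Psi> f L u (x i) (xt i) \<le> M"
  shows "avg_error \<Psi> f L \<mu> u x xt k \<le> M"
proof -
  have "(\<Sum>i=1..k. (L / (L - \<mu>)) ^ i * step_error \<Psi> f L u (x i) (xt i))
      \<le> (\<Sum>i=1..k. (L / (L - \<mu>)) ^ i * M)"
    using assms(1,2) by (intro sum_mono mult_left_mono M) auto
  then show ?thesis
    using geometric_average_factor(1)[OF assms(1-3)]
    by (simp add: avg_error_def pos_divide_le_eq sum_distrib_left mult.commute)
qed

section \<open>The convergence bound\<close>

theorem theorem3p6:
  fixes \<Psi> f :: "real ^ 'n \<Rightarrow> real"
    and L \<mu> :: real
    and x xt :: "nat \<Rightarrow> real ^ 'n"
    and u :: "real ^ 'n"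
    and k :: nat
  assumes "mirror_potential \<Psi>"
    and "\<forall>z. f differentiable (at z)"
    and "convex_on UNIV f"
    and "\<exists>z. is_arg_min f (\<lambda>_. True) z"
    and "L > 0" and "\<mu> \<ge> 0"
    and "L \<noteq> \<mu>"
    and "rel_smooth \<Psi> L f"
    and "rel_strongly_convex \<Psi> \<mu> f"
    and "\<forall>j. x (Suc j) =
      (ARG_MIN (\<lambda>z. z \<bullet> grad f (xt j) + L * bregman \<Psi> z (xt j)) z. True)"
    and "k \<ge> 1"
  shows "(MIN i\<in>{1..k}. f (xt i)) - f u
      \<le> (L - \<mu>) / real k * bregman \<Psi> u (xt 0) + avg_error \<Psi> f L \<mu> u x xt k
    \<and> (\<mu> \<noteq> 0 \<longrightarrow>
        (MIN i\<in>{1..k}. f (xt i)) - f u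
          \<le> \<mu> * bregman \<Psi> u (xt 0) / ((1 + \<mu> / (L - \<mu>)) ^ k - 1) + avg_error \<Psi> f L \<mu> u x xt k
      \<and> \<mu> * bregman \<Psi> u (xt 0) / ((1 + \<mu> / (L - \<mu>)) ^ k - 1) + avg_error \<Psi> f L \<mu> u x xt k
          \<le> (L - \<mu>) / real k * bregman \<Psi> u (xt 0) + avg_error \<Psi> f L \<mu> u x xt k)
    \<and> (\<forall>M. (\<forall>i\<ge>1. step_error \<Psi> f L u (x i) (xt i) \<le> M) \<longrightarrow>
        (MIN i\<in>{1..k}. f (xt i)) - f u
          \<le> (L - \<mu>) / real k * bregman \<Psi> u (xt 0) + M
      \<and> (\<mu> \<noteq> 0 \<longrightarrow>
          (MIN i\<in>{1..k}. f (xt i)) - f u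
            \<le> \<mu> * bregman \<Psi> u (xt 0) / ((1 + \<mu> / (L - \<mu>)) ^ k - 1) + M
        \<and> \<mu> * bregman \<Psi> u (xt 0) / ((1 + \<mu> / (L - \<mu>)) ^ k - 1) + M
            \<le> (L - \<mu>) / real k * bregman \<Psi> u (xt 0) + M))"
proof -
  note \<Psi> = assms(1) and L = assms(5) and \<mu> = assms(6)
  have less: "\<mu> < L"
    using rel_convexity_le_rel_smoothness[OF \<Psi> assms(8,9)] assms(7) by simp
  define W where "W = (\<Sum>i=1..k. (L / (L - \<mu>)) ^ i)"
  define D where "D = (MIN i\<in>{1..k}. f (xt i)) - f u"
  define B where "B = bregman \<Psi> u (xt 0)"
  define E where "E = avg_error \<Psi> f L \<mu> u x xt k"
  note factor = geometric_average_factor[OF \<mu> less assms(11), folded W_def]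
  have B: "B \<ge> 0"
    unfolding B_def by (rule bregman_nonneg[OF \<Psi>])
  have "W * D = (\<Sum>i=1..k. (L / (L - \<mu>)) ^ i * D)"
    by (simp add: W_def sum_distrib_right)
  also have "\<dots> \<le> (\<Sum>i=1..k. (L / (L - \<mu>)) ^ i * (f (xt i) - f u))"
    using L less by (intro sum_mono mult_left_mono) (auto simp: D_def)
  also have "\<dots> \<le> L * B
      + (\<Sum>i=1..k. (L / (L - \<mu>)) ^ i * step_error \<Psi> f L u (x i) (xt i))"
  proof -
    have "f (xt (Suc i)) - f u \<le> (L - \<mu>) * bregman \<Psi> u (xt i) - L * bregman \<Psi> u (xt (Suc i))
        + step_error \<Psi> f L u (x (Suc i)) (xt (Suc i))" for i
      using assms(10)
      by (intro mirror_step_gap[OF assms(8,9)] mirror_step_optimality[OF \<Psi> L]) blast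
    then have "(\<Sum>i=1..k. (L / (L - \<mu>)) ^ i * (f (xt i) - f u))
        + L * (L / (L - \<mu>)) ^ k * bregman \<Psi> u (xt k)
        \<le> L * B + (\<Sum>i=1..k. (L / (L - \<mu>)) ^ i * step_error \<Psi> f L u (x i) (xt i))"
      unfolding B_def by (rule weighted_telescoping[OF L less])
    moreover have "L * (L / (L - \<mu>)) ^ k * bregman \<Psi> u (xt k) \<ge> 0"
      using L less bregman_nonneg[OF \<Psi>] by simp
    ultimately show ?thesis
      by linarith
  qed
  also have "\<dots> = W * (L / W * B + E)"
    using factor(1) unfolding E_def avg_error_def W_def[symmetric] by (simp add: algebra_simps)
  finally have gap: "D \<le> L / W * B + E"
    using factor(1) by simp
  have middle: "\<mu> * B / ((1 + \<mu> / (L - \<mu>)) ^ k - 1) = L / W * B" if "\<mu> \<noteq> 0"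
    using factor(3)[OF that] by (metis times_divide_eq_left)
  have last: "L / W * B \<le> (L - \<mu>) / real k * B"
    using factor(2) B by (rule mult_right_mono)
  have "E \<le> M" if "\<forall>i\<ge>1. step_error \<Psi> f L u (x i) (xt i) \<le> M" for M
    unfolding E_def using that by (intro avg_error_le[OF \<mu> less assms(11)]) blast
  then show ?thesis
    unfolding D_def[symmetric] B_def[symmetric] E_def[symmetric]
    using gap middle last by (smt (verit))
qed

end
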